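(* Let $\mathfrak{A}$ be a first-order expansion of $(\mathbb{Q};<)$ with a finite relational signature such that $\min$, $\mathrm{mi}$, $\mathrm{mx}$, $\mathrm{ll}$ or one of their duals is a polymorphism of $\mathfrak{A}$. Then the following are equivalent: (i) $\mathfrak{A}$ does not have a binary injective polymorphism; (ii) $R^{\mathrm{mix}}$ or its dual $-R^{\mathrm{mix}}$ has a primitive positive definition in $\mathfrak{A}$.
   Context: A first-order expansion of $(\mathbb{Q};<)$ is a relational structure on $\mathbb{Q}$ obtained from $(\mathbb{Q};<)$ by adding relations that are first-order definable in $(\mathbb{Q};<)$. An operation $f\colon\mathbb{Q}^m\to\mathbb{Q}$ preserves $R\subseteq\mathbb{Q}^n$ if $f(t_1,\dots,t_m)\in R$ (componentwise) for all $t_1,\dots,t_m\in R$; $f$ is a polymorphism of $\mathfrak{A}$ if it preserves all relations of $\mathfrak{A}$. A relation has a primitive positive definition in $\mathfrak{A}$ if it is defined in $\mathfrak{A}$ by an existentially quantified conjunction of atomic formulas ($x=y$, $\bot$, or $R(x_1,\dots,x_n)$ with $R$ a relation symbol of $\mathfrak{A}$). $R^{\mathrm{mix}} := \{(a_1,a_2,a_3)\in\mathbb{Q}^3 \mid (a_1=a_2)\vee(a_3<a_1\wedge a_3<a_2)\}$. The dual of a relation $R\subseteq\mathbb{Q}^n$ is $-R := \{(a_1,\dots,a_n)\in\mathbb{Q}^n\mid(-a_1,\dots,-a_n)\in R\}$; the dual of an operation $f$ is $(x_1,\dots,x_n)\mapsto -f(-x_1,\dots,-x_n)$. $\min$ is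 the binary minimum on $\mathbb{Q}$. $\mathrm{mi}$: fix endomorphisms $\alpha,\beta,\gamma$ of $(\mathbb{Q};<)$ with $\alpha(a)<\beta(a)<\gamma(a)<\alpha(a+\epsilon)$ for all $a,\epsilon\in\mathbb{Q}$, $\epsilon>0$; then $\mathrm{mi}(x,y)=\alpha(x)$ if $x=y$, $\beta(y)$ if $x>y$, $\gamma(x)$ if $x<y$. $\mathrm{mx}$: fix endomorphisms $\alpha,\beta$ of $(\mathbb{Q};<)$ with $\alpha(a)<\beta(a)<\alpha(a+\epsilon)$ for all $a,\epsilon\in\mathbb{Q}$, $\epsilon>0$; then $\mathrm{mx}(x,y)=\alpha(\min(x,y))$ if $x\neq y$ and $\beta(x)$ if $x=y$. $\mathrm{ll}$: an arbitrary operation $\mathbb{Q}^2\to\mathbb{Q}$ such that $\mathrm{ll}(a,b)<\mathrm{ll}(a',b')$ if and only if one of the following holds: $a\le0$ and $a<a'$; $a\le0$, $a=a'$ and $b<b'$; $a,a'>0$ and $b<b'$; $a>0$, $b=b'$ and $a<a'$. These operations are determined only up to the weak linear order they induce on $\mathbb{Q}^2$; the particular choice is irrelevant for which first-order expansions of $(\mathbb{Q};<)$ they preserve. *)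

theory Defs
  imports Complex_Main
begin

text \<open>Relational structures whose domain is the whole type \<open>'a\<close>; \<open>k\<close>-ary relations are sets of
  lists of length \<open>k\<close>.\<close>

record ('s, 'a) rel_struct =
  symbols :: "'s set"
  arity :: "'s \<Rightarrow> nat"
  interp :: "'s \<Rightarrow> 'a list set"

datatype 's fm =
    FBot
  | FEq nat nat
  | FRel 's "nat list"
  | FNeg "'s fm"
  | FConj "'s fm" "'s fm"
  | FEx nat "'s fm"

fun wf_fm :: "('s, 'a) rel_struct \<Rightarrow> 's fm \<Rightarrow> bool" where
  "wf_fm A FBot \<longleftrightarrow> True"
| "wf_fm A (FEq x y) \<longleftrightarrow> True"
| "wf_fm A (FRel s xs) \<longleftrightarrow> s \<in> symbols A \<and> length xs = arity A s"
| "wf_fm A (FNeg \<phi>) \<longleftrightarrow> wf_fm A \<phi>"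
| "wf_fm A (FConj \<phi> \<psi>) \<longleftrightarrow> wf_fm A \<phi> \<and> wf_fm A \<psi>"
| "wf_fm A (FEx x \<phi>) \<longleftrightarrow> wf_fm A \<phi>"

fun free_vars :: "'s fm \<Rightarrow> nat set" where
  "free_vars FBot = {}"
| "free_vars (FEq x y) = {x, y}"
| "free_vars (FRel s xs) = set xs"
| "free_vars (FNeg \<phi>) = free_vars \<phi>"
| "free_vars (FConj \<phi> \<psi>) = free_vars \<phi> \<union> free_vars \<psi>"
| "free_vars (FEx x \<phi>) = free_vars \<phi> - {x}"

fun sat :: "('s, 'a) rel_struct \<Rightarrow> (nat \<Rightarrow> 'a) \<Rightarrow> 's fm \<Rightarrow> bool" where
  "sat A v FBot \<longleftrightarrow> False"
| "sat A v (FEq x y) \<longleftrightarrow> v x = v y"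
| "sat A v (FRel s xs) \<longleftrightarrow> map v xs \<in> interp A s"
| "sat A v (FNeg \<phi>) \<longleftrightarrow> \<not> sat A v \<phi>"
| "sat A v (FConj \<phi> \<psi>) \<longleftrightarrow> sat A v \<phi> \<and> sat A v \<psi>"
| "sat A v (FEx x \<phi>) \<longleftrightarrow> (\<exists>a. sat A (v(x := a)) \<phi>)"

fun conj_of_atoms :: "'s fm \<Rightarrow> bool" where
  "conj_of_atoms FBot \<longleftrightarrow> True"
| "conj_of_atoms (FEq x y) \<longleftrightarrow> True"
| "conj_of_atoms (FRel s xs) \<longleftrightarrow> True"
| "conj_of_atoms (FNeg \<phi>) \<longleftrightarrow> False"
| "conj_of_atoms (FConj \<phi> \<psi>) \<longleftrightarrow> conj_of_atoms \<phi> \<and> conj_of_atoms \<psi>"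
| "conj_of_atoms (FEx x \<phi>) \<longleftrightarrow> False"

fun primitive_positive :: "'s fm \<Rightarrow> bool" where
  "primitive_positive (FEx x \<phi>) \<longleftrightarrow> primitive_positive \<phi>"
| "primitive_positive \<phi> \<longleftrightarrow> conj_of_atoms \<phi>"

text \<open>A formula with free variables among \<open>0, \<dots>, n - 1\<close> defines an \<open>n\<close>-ary relation.\<close>

definition defines_rel :: "('s, 'a) rel_struct \<Rightarrow> nat \<Rightarrow> 's fm \<Rightarrow> 'a list set \<Rightarrow> bool" where
  "defines_rel A n \<phi> R \<longleftrightarrow>
     wf_fm A \<phi> \<and> free_vars \<phi> \<subseteq> {..<n} \<and> R = {map v [0..<n] | v. sat A v \<phi>}"

definition fo_definable :: "('s, 'a) rel_struct \<Rightarrow> nat \<Rightarrow> 'a list set \<Rightarrow> bool" where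
  "fo_definable A n R \<longleftrightarrow> (\<exists>\<phi>. defines_rel A n \<phi> R)"

definition pp_definable :: "('s, 'a) rel_struct \<Rightarrow> nat \<Rightarrow> 'a list set \<Rightarrow> bool" where
  "pp_definable A n R \<longleftrightarrow> (\<exists>\<phi>. primitive_positive \<phi> \<and> defines_rel A n \<phi> R)"

definition less_rel :: "rat list set" where
  "less_rel = {[x, y] | x y. x < y}"

definition rat_order :: "(unit, rat) rel_struct" where
  "rat_order = \<lparr>symbols = {()}, arity = (\<lambda>_. 2), interp = (\<lambda>_. less_rel)\<rparr>"

text \<open>That every \<open>interp A s\<close> contains only lists of length \<open>arity A s\<close> is part of
  \<^const>\<open>fo_definable\<close>.\<close>

definition fo_expansion :: "('s, rat) rel_struct \<Rightarrow> bool" where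
  "fo_expansion A \<longleftrightarrow>
     (\<exists>s\<in>symbols A. arity A s = 2 \<and> interp A s = less_rel) \<and>
     (\<forall>s\<in>symbols A. fo_definable rat_order (arity A s) (interp A s))"

definition preserves :: "('a \<Rightarrow> 'a \<Rightarrow> 'a) \<Rightarrow> 'a list set \<Rightarrow> bool" where
  "preserves f R \<longleftrightarrow> (\<forall>s\<in>R. \<forall>t\<in>R. map2 f s t \<in> R)"

definition binary_polymorphism :: "('s, 'a) rel_struct \<Rightarrow> ('a \<Rightarrow> 'a \<Rightarrow> 'a) \<Rightarrow> bool" where
  "binary_polymorphism A f \<longleftrightarrow> (\<forall>s\<in>symbols A. preserves f (interp A s))"

definition dual_op :: "(rat \<Rightarrow> rat \<Rightarrow> rat) \<Rightarrow> rat \<Rightarrow> rat \<Rightarrow> rat" where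
  "dual_op f = (\<lambda>x y. - f (- x) (- y))"

definition dual_rel :: "rat list set \<Rightarrow> rat list set" where
  "dual_rel R = {t. map uminus t \<in> R}"

definition R_mix :: "rat list set" where
  "R_mix = {[a1, a2, a3] | a1 a2 a3. a1 = a2 \<or> (a3 < a1 \<and> a3 < a2)}"

text \<open>The operations mi, mx and ll are determined only up to the weak linear order they induce
  on pairs, so each is given by the property of being one of the possible choices.
  Endomorphisms of the strict order on the rationals are the strictly monotone maps.\<close>

definition is_mi :: "(rat \<Rightarrow> rat \<Rightarrow> rat) \<Rightarrow> bool" where
  "is_mi f \<longleftrightarrow> (\<exists>\<alpha> \<beta> \<gamma> :: rat \<Rightarrow> rat.
     strict_mono \<alpha> \<and> strict_mono \<beta> \<and> strict_mono \<gamma> \<and>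
     (\<forall>a \<epsilon>. \<epsilon> > 0 \<longrightarrow> \<alpha> a < \<beta> a \<and> \<beta> a < \<gamma> a \<and> \<gamma> a < \<alpha> (a + \<epsilon>)) \<and>
     (\<forall>x y. f x y = (if x = y then \<alpha> x else if x > y then \<beta> y else \<gamma> x)))"

definition is_mx :: "(rat \<Rightarrow> rat \<Rightarrow> rat) \<Rightarrow> bool" where
  "is_mx f \<longleftrightarrow> (\<exists>\<alpha> \<beta> :: rat \<Rightarrow> rat.
     strict_mono \<alpha> \<and> strict_mono \<beta> \<and>
     (\<forall>a \<epsilon>. \<epsilon> > 0 \<longrightarrow> \<alpha> a < \<beta> a \<and> \<beta> a < \<alpha> (a + \<epsilon>)) \<and>
     (\<forall>x y. f x y = (if x \<noteq> y then \<alpha> (min x y) else \<beta> x)))"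

definition is_ll :: "(rat \<Rightarrow> rat \<Rightarrow> rat) \<Rightarrow> bool" where
  "is_ll f \<longleftrightarrow> (\<forall>a b a' b'. f a b < f a' b' \<longleftrightarrow>
     (a \<le> 0 \<and> a < a') \<or>
     (a \<le> 0 \<and> a = a' \<and> b < b') \<or>
     (a > 0 \<and> a' > 0 \<and> b < b') \<or>
     (a > 0 \<and> b = b' \<and> a < a'))"

end

theory Submission
  imports Defs "HOL-Library.Diagonal_Subsequence" "HOL-Library.Infinite_Set"
    "HOL-Library.Countable"
begin

text \<open>
  A binary injective operation \<open>g\<close> cannot preserve \<open>R_mix\<close>: applied to the triples
  \<open>(0, 0, 1)\<close> and \<open>(1, 2, 0)\<close>, in both orders, it would have to satisfy both \<open>g 1 0 < g 0 1\<close> and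
  \<open>g 0 1 < g 1 0\<close>. Since polymorphisms preserve whatever is primitively positively definable, this
  excludes injective polymorphisms as soon as \<open>R_mix\<close> or its dual is definable. An operation of
  type ll is itself injective, so both sides of the equivalence fail for it. What remains is to
  define \<open>R_mix\<close> when there is no injective polymorphism and \<open>f\<close> is min, mi or mx; the dual
  operations are reduced to these by reversing the order.

  Of min, mi and mx only one property matters: \<open>f a b < f a' b'\<close> whenever
  \<open>min a b < min a' b'\<close> (\<open>refines_min\<close>). By compactness
  (\<open>injective_polymorphism_compactness\<close>) there is a finite set \<open>F\<close> such that no partial polymorphism
  on \<open>F \<times> F\<close> is injective. These partial polymorphisms are the solutions of a finite network of
  constraints, among which are the two projections, so any two variables are separated by some solution.
  Take a solution \<open>s\<close> with as many strict comparisons between variables as possible, and let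
  \<open>p\<close>, \<open>q\<close> be variables that it identifies. By maximality, adding to the network all comparisons valid
  in \<open>s\<close> entails \<open>p = q\<close>. Adding them one at a time, one meets a network where \<open>p = q\<close> is not yet
  entailed but becomes so after adding one more comparison \<open>i < j\<close>
  (\<open>entailed_equality_exists\<close>).

  Combine by \<open>f\<close> a solution \<open>s\<close> with \<open>i < j\<close> and a solution \<open>t\<close> with \<open>p \<noteq> q\<close>, after moving \<open>t\<close> along
  the rational line by some order-preserving map. Unless \<open>s p \<le> s i\<close>, \<open>t j \<le> t p\<close> and
  \<open>t j \<le> t q\<close>, the result can be made to satisfy both \<open>i < j\<close> and \<open>p \<noteq> q\<close>, which is
  impossible (\<open>entailed_equality_bounds\<close>). Now let \<open>S\<close> be the relation of all triples \<open>(u, w, c)\<close> such that some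
  solution has \<open>p = u\<close>, \<open>q = w\<close> and \<open>c < j\<close>. The bounds on \<open>t\<close> give \<open>S \<subseteq> R_mix\<close>; the
  bound on \<open>s\<close> leaves room to move \<open>j\<close> arbitrarily far above \<open>p = q\<close>, so \<open>S\<close> contains all triples with \<open>u = w\<close>;
  and if \<open>p\<close> and \<open>q\<close> are named so that \<open>t p < t q\<close>, then \<open>S\<close> contains all triples with
  \<open>c < u < w\<close>. Consequently \<open>R_mix (x, y, c)\<close> holds iff \<open>S (z, x, c)\<close> and \<open>S (z, y, c)\<close> for some
  \<open>z\<close>, namely for \<open>z = min x y\<close> (\<open>R_mix_network\<close>).
\<close>

section \<open>Relations that depend only on the order type\<close>

definition order_invariant :: "rat list set \<Rightarrow> bool" where
  "order_invariant R \<longleftrightarrow> (\<forall>xs\<in>R. \<forall>ys. length ys = length xs \<longrightarrow>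
     (\<forall>i<length xs. \<forall>j<length xs. xs ! i < xs ! j \<longleftrightarrow> ys ! i < ys ! j) \<longrightarrow> ys \<in> R)"

lemma order_invariant_map:
  assumes "order_invariant R" "map v xs \<in> R"
    and "\<And>i j. i \<in> set xs \<Longrightarrow> j \<in> set xs \<Longrightarrow> v i < v j \<longleftrightarrow> w i < w j"
  shows "map w xs \<in> R"
proof -
  have "\<forall>i<length xs. \<forall>j<length xs. map v xs ! i < map v xs ! j \<longleftrightarrow> map w xs ! i < map w xs ! j"
    using assms(3) by simp
  then show ?thesis using assms(1,2) unfolding order_invariant_def by (metis length_map)
qed

lemma rat_between_finite_sets:
  fixes L U :: "rat set"
  assumes "finite L" "finite U" "\<And>l u. l \<in> L \<Longrightarrow> u \<in> U \<Longrightarrow> l < u"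
  shows "\<exists>b. (\<forall>l\<in>L. l < b) \<and> (\<forall>u\<in>U. b < u)"
proof (cases "L = {}")
  case True
  show ?thesis
  proof (cases "U = {}")
    case False
    obtain b where "b < Min U" using lt_ex by blast
    then show ?thesis using True False assms(2) by (auto intro: exI[of _ b])
  qed (use True in auto)
next
  case False
  show ?thesis
  proof (cases "U = {}")
    case True
    obtain b where "Max L < b" using gt_ex by blast
    then show ?thesis using True False assms(1) by (auto intro: exI[of _ b])
  next
    case U: False
    have "Max L < Min U" using assms False U by simp
    then obtain b where "Max L < b" "b < Min U" using dense by blast
    then show ?thesis using U False assms(1,2) by (auto intro: exI[of _ b])
  qed
qed

text \<open>The forth step of the back-and-forth argument, which rests on density and on the absence of
  endpoints.\<close>

lemma order_type_extend:
  fixes v w :: "'i \<Rightarrow> rat"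
  assumes "finite X" and vw: "\<And>i j. i \<in> X \<Longrightarrow> j \<in> X \<Longrightarrow> v i < v j \<longleftrightarrow> w i < w j"
  shows "\<exists>b. \<forall>i\<in>X. (v i < a \<longleftrightarrow> w i < b) \<and> (a < v i \<longleftrightarrow> b < w i)"
proof (cases "a \<in> v ` X")
  case True
  then obtain k where "k \<in> X" "a = v k" by auto
  then show ?thesis using vw by (auto intro!: exI[of _ "w k"])
next
  case False
  have "\<exists>b. (\<forall>l\<in>w ` {i\<in>X. v i < a}. l < b) \<and> (\<forall>u\<in>w ` {i\<in>X. a < v i}. b < u)"
  proof (rule rat_between_finite_sets)
    fix l u assume "l \<in> w ` {i\<in>X. v i < a}" "u \<in> w ` {i\<in>X. a < v i}"
    then show "l < u" using vw by (auto dest: less_trans)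
  qed (use assms(1) in auto)
  then obtain b where b: "\<And>i. i \<in> X \<Longrightarrow> v i < a \<Longrightarrow> w i < b" "\<And>i. i \<in> X \<Longrightarrow> a < v i \<Longrightarrow> b < w i"
    by auto
  have "(v i < a \<longleftrightarrow> w i < b) \<and> (a < v i \<longleftrightarrow> b < w i)" if "i \<in> X" for i
    using b[OF that] False that by (metis imageI less_asym linorder_neqE)
  then show ?thesis by blast
qed

lemma finite_free_vars: "finite (free_vars \<phi>)"
  by (induction \<phi>) auto

text \<open>Stating invariance for partial isomorphisms instead of automorphisms lets the induction pass
  quantifiers with a one-point extension, so no automorphism ever has to be constructed.\<close>

lemma sat_rat_order_cong:
  assumes "wf_fm rat_order \<phi>"
    and "\<And>i j. i \<in> free_vars \<phi> \<Longrightarrow> j \<in> free_vars \<phi> \<Longrightarrow> v i < v j \<longleftrightarrow> w i < w j"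
  shows "sat rat_order v \<phi> \<longleftrightarrow> sat rat_order w \<phi>"
  using assms
proof (induction \<phi> arbitrary: v w)
  case (FEq x y)
  have "v x < v y \<longleftrightarrow> w x < w y" "v y < v x \<longleftrightarrow> w y < w x" using FEq.prems(2) by auto
  then show ?case by (simp only: sat.simps) (metis linorder_neqE less_irrefl)
next
  case (FRel s xs)
  then obtain x y where "xs = [x, y]"
    by (auto simp: rat_order_def length_Suc_conv numeral_2_eq_2)
  then show ?case using FRel.prems(2)[of x y] by (simp add: rat_order_def less_rel_def)
next
  case (FConj \<phi> \<psi>)
  have "sat rat_order v \<phi> \<longleftrightarrow> sat rat_order w \<phi>" "sat rat_order v \<psi> \<longleftrightarrow> sat rat_order w \<psi>"
    using FConj.prems by (auto intro!: FConj.IH)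
  then show ?case by simp
next
  case (FEx x \<phi>)
  have wf: "wf_fm rat_order \<phi>" using FEx.prems(1) by simp
  have fin: "finite (free_vars \<phi> - {x})" by (simp add: finite_free_vars)
  have step: "\<exists>b. sat rat_order (w'(x := b)) \<phi>"
    if sat: "sat rat_order (v'(x := a)) \<phi>"
      and eq: "\<And>i j. i \<in> free_vars \<phi> - {x} \<Longrightarrow> j \<in> free_vars \<phi> - {x} \<Longrightarrow> v' i < v' j \<longleftrightarrow> w' i < w' j"
    for v' w' :: "nat \<Rightarrow> rat" and a
  proof -
    obtain b where b: "\<forall>i\<in>free_vars \<phi> - {x}. (v' i < a \<longleftrightarrow> w' i < b) \<and> (a < v' i \<longleftrightarrow> b < w' i)"
      using order_type_extend[OF fin, of v' w' a] eq by blast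
    have "sat rat_order (v'(x := a)) \<phi> \<longleftrightarrow> sat rat_order (w'(x := b)) \<phi>"
      by (rule FEx.IH[OF wf]) (use b eq in auto)
    then show ?thesis using sat by blast
  qed
  have eq: "v i < v j \<longleftrightarrow> w i < w j" if "i \<in> free_vars \<phi> - {x}" "j \<in> free_vars \<phi> - {x}" for i j
    using FEx.prems(2) that by simp
  show ?case unfolding sat.simps
  proof
    assume "\<exists>a. sat rat_order (v(x := a)) \<phi>"
    then show "\<exists>b. sat rat_order (w(x := b)) \<phi>" using step[of v _ w, OF _ eq] by blast
  next
    assume "\<exists>b. sat rat_order (w(x := b)) \<phi>"
    then show "\<exists>a. sat rat_order (v(x := a)) \<phi>" using step[of w _ v, OF _ eq[symmetric]] by blast
  qed
next
  case (FNeg \<phi>)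
  have "sat rat_order v \<phi> \<longleftrightarrow> sat rat_order w \<phi>"
    by (rule FNeg.IH) (use FNeg.prems in simp_all)
  then show ?case by simp
qed simp

lemma fo_definable_order_invariant:
  assumes "fo_definable rat_order n R"
  shows "order_invariant R"
proof -
  obtain \<phi> where \<phi>: "wf_fm rat_order \<phi>" "free_vars \<phi> \<subseteq> {..<n}"
    "R = {map v [0..<n] | v. sat rat_order v \<phi>}"
    using assms by (auto simp: fo_definable_def defines_rel_def)
  show ?thesis unfolding order_invariant_def
  proof (intro ballI allI impI)
    fix xs ys :: "rat list" assume "xs \<in> R" and len: "length ys = length xs"
      and ord: "\<forall>i<length xs. \<forall>j<length xs. xs ! i < xs ! j \<longleftrightarrow> ys ! i < ys ! j"
    then obtain v where v: "xs = map v [0..<n]" "sat rat_order v \<phi>" using \<phi>(3) by auto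
    have "sat rat_order v \<phi> \<longleftrightarrow> sat rat_order ((!) ys) \<phi>"
    proof (rule sat_rat_order_cong[OF \<phi>(1)])
      fix i j assume "i \<in> free_vars \<phi>" "j \<in> free_vars \<phi>"
      then have "i < n" "j < n" using \<phi>(2) by auto
      then show "v i < v j \<longleftrightarrow> ys ! i < ys ! j" using ord v(1) by auto
    qed
    moreover have "ys = map ((!) ys) [0..<n]" using len v(1) by (simp add: list_eq_iff_nth_eq)
    ultimately show "ys \<in> R" using v(2) \<phi>(3) by blast
  qed
qed

section \<open>Constraint networks and primitive positive definitions\<close>

text \<open>A network is a primitive positive formula with the quantifiers and the names of its
  variables forgotten. Order constraints are kept apart because in the dual structure
  they are not among the relations, yet remain expressible with the two arguments exchanged.\<close>

definition network ::
    "('s, rat) rel_struct \<Rightarrow> ('s \<times> 'i list) set \<Rightarrow> ('i \<times> 'i) set \<Rightarrow> bool" where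
  "network A C D \<longleftrightarrow> finite C \<and> finite D \<and>
     (\<forall>(s, xs)\<in>C. s \<in> symbols A \<and> length xs = arity A s)"

definition solutions ::
    "('s, rat) rel_struct \<Rightarrow> ('s \<times> 'i list) set \<Rightarrow> ('i \<times> 'i) set \<Rightarrow> ('i \<Rightarrow> rat) set" where
  "solutions A C D =
     {v. (\<forall>(s, xs)\<in>C. map v xs \<in> interp A s) \<and> (\<forall>(i, j)\<in>D. v i < v j)}"

lemma sat_foldr_FConj:
  "sat A v (foldr FConj \<phi>s \<psi>) \<longleftrightarrow> (\<forall>\<phi>\<in>set \<phi>s. sat A v \<phi>) \<and> sat A v \<psi>"
  by (induction \<phi>s) auto

lemma wf_foldr_FConj:
  "wf_fm A (foldr FConj \<phi>s \<psi>) \<longleftrightarrow> (\<forall>\<phi>\<in>set \<phi>s. wf_fm A \<phi>) \<and> wf_fm A \<psi>"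
  by (induction \<phi>s) auto

lemma conj_of_atoms_foldr_FConj:
  "conj_of_atoms (foldr FConj \<phi>s \<psi>) \<longleftrightarrow> (\<forall>\<phi>\<in>set \<phi>s. conj_of_atoms \<phi>) \<and> conj_of_atoms \<psi>"
  by (induction \<phi>s) auto

lemma sat_foldr_FEx:
  "sat A v (foldr FEx xs \<phi>) \<longleftrightarrow> (\<exists>w. (\<forall>x. x \<notin> set xs \<longrightarrow> w x = v x) \<and> sat A w \<phi>)"
proof (induction xs arbitrary: v)
  case Nil
  have "w = v" if "\<forall>x. w x = v x" for w using that by blast
  then show ?case by auto
next
  case (Cons y xs)
  show ?case
  proof
    assume "sat A v (foldr FEx (y # xs) \<phi>)"
    then obtain a where "sat A (v(y := a)) (foldr FEx xs \<phi>)" by auto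
    then obtain w where "\<forall>x. x \<notin> set xs \<longrightarrow> w x = (v(y := a)) x" "sat A w \<phi>"
      using Cons.IH by blast
    then show "\<exists>w. (\<forall>x. x \<notin> set (y # xs) \<longrightarrow> w x = v x) \<and> sat A w \<phi>"
      by (intro exI[of _ w]) auto
  next
    assume "\<exists>w. (\<forall>x. x \<notin> set (y # xs) \<longrightarrow> w x = v x) \<and> sat A w \<phi>"
    then obtain w where w: "\<forall>x. x \<notin> set (y # xs) \<longrightarrow> w x = v x" "sat A w \<phi>" by blast
    then have "\<forall>x. x \<notin> set xs \<longrightarrow> w x = (v(y := w y)) x" by auto
    then have "sat A (v(y := w y)) (foldr FEx xs \<phi>)" using Cons.IH w(2) by blast
    then show "sat A v (foldr FEx (y # xs) \<phi>)" by auto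
  qed
qed

lemma free_vars_foldr_FEx: "free_vars (foldr FEx xs \<phi>) = free_vars \<phi> - set xs"
  by (induction xs) auto

lemma wf_foldr_FEx: "wf_fm A (foldr FEx xs \<phi>) \<longleftrightarrow> wf_fm A \<phi>"
  by (induction xs) auto

lemma primitive_positive_foldr_FEx:
  "conj_of_atoms \<phi> \<Longrightarrow> primitive_positive (foldr FEx xs \<phi>)"
  by (induction xs) (cases \<phi>; simp)+

lemma pp_definable_conj_of_atoms:
  assumes "conj_of_atoms \<phi>" "wf_fm A \<phi>"
  shows "pp_definable A n {map v [0..<n] | v. sat A v \<phi>}"
proof -
  obtain xs where xs: "set xs = free_vars \<phi> - {..<n}"
    using finite_list[of "free_vars \<phi> - {..<n}"] finite_free_vars by blast
  define \<chi> where "\<chi> = foldr FEx xs \<phi>"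
  have "{map v [0..<n] | v. sat A v \<phi>} = {map v [0..<n] | v. sat A v \<chi>}" (is "?L = ?R")
  proof
    show "?L \<subseteq> ?R" unfolding \<chi>_def sat_foldr_FEx by blast
    show "?R \<subseteq> ?L"
    proof
      fix t assume "t \<in> ?R"
      then obtain v w where "t = map v [0..<n]" "\<forall>x. x \<notin> set xs \<longrightarrow> w x = v x" "sat A w \<phi>"
        unfolding \<chi>_def sat_foldr_FEx by blast
      moreover from this have "map v [0..<n] = map w [0..<n]" using xs by auto
      ultimately show "t \<in> ?L" by auto
    qed
  qed
  then have "defines_rel A n \<chi> {map v [0..<n] | v. sat A v \<phi>}"
    unfolding defines_rel_def using assms(2) xs
    by (auto simp: \<chi>_def wf_foldr_FEx free_vars_foldr_FEx)
  then show ?thesis unfolding pp_definable_def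
    using primitive_positive_foldr_FEx[OF assms(1)] \<chi>_def by blast
qed

text \<open>Networks may use any countable type of variables and any tuple of variables, repeated or not, as
  output. This is what makes it convenient to use pairs of rationals as variables and to glue
  two copies of a network along a variable.\<close>

lemma network_pp_definable:
  fixes js :: "'i::countable list"
  assumes net: "network A C D" and l: "l \<in> symbols A" "arity A l = 2" "interp A l = less_rel"
  shows "pp_definable A (length js) {map v js | v. v \<in> solutions A C D}"
proof -
  define n where "n = length js"
  \<comment> \<open>the variables below \<open>n\<close> are reserved for the coordinates of the defined relation\<close>
  define e where "e = (\<lambda>i::'i. to_nat i + n)"
  define atoms where "atoms = (\<lambda>(s, xs). FRel s (map e xs)) ` C \<union> (\<lambda>(i, j). FRel l [e i, e j]) ` D
     \<union> (\<lambda>k. FEq k (e (js ! k))) ` {..<n}"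
  have "finite atoms" using net by (auto simp: atoms_def network_def)
  then obtain \<phi>s where \<phi>s: "set \<phi>s = atoms" using finite_list by blast
  \<comment> \<open>the trivial equation \<open>n = n\<close> serves as the empty conjunction\<close>
  define \<phi> where "\<phi> = foldr FConj \<phi>s (FEq n n)"
  have sat: "sat A w \<phi> \<longleftrightarrow> w \<circ> e \<in> solutions A C D \<and> (\<forall>k<n. w k = w (e (js ! k)))" for w
    unfolding \<phi>_def sat_foldr_FConj \<phi>s
    by (auto simp: atoms_def solutions_def l(3) less_rel_def ball_Un split: prod.splits)
  have "{map w [0..<n] | w. sat A w \<phi>} = {map v js | v. v \<in> solutions A C D}" (is "?L = ?R")
  proof
    show "?L \<subseteq> ?R"
    proof
      fix t assume "t \<in> ?L"
      then obtain w where w: "t = map w [0..<n]" "sat A w \<phi>" by blast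
      have eq: "w k = w (e (js ! k))" if "k < n" for k using w(2) sat that by blast
      have "t = map (w \<circ> e) js"
      proof (rule nth_equalityI)
        fix k assume "k < length t"
        then have "k < n" by (simp add: w(1))
        then show "t ! k = map (w \<circ> e) js ! k" using eq[of k] by (simp add: w(1) n_def)
      qed (simp add: w(1) n_def)
      then show "t \<in> ?R" using w sat by blast
    qed
    show "?R \<subseteq> ?L"
    proof
      fix t assume "t \<in> ?R"
      then obtain v where v: "t = map v js" "v \<in> solutions A C D" by blast
      define w where "w = (\<lambda>k. if k < n then v (js ! k) else v (from_nat (k - n)))"
      have "w \<circ> e = v" by (simp add: fun_eq_iff w_def e_def)
      moreover have "t = map w [0..<n]"
        by (rule nth_equalityI) (simp_all add: n_def w_def v(1))
      moreover have "\<forall>k<n. w k = w (e (js ! k))" by (simp add: w_def e_def)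
      ultimately show "t \<in> ?L" using v(2) sat[of w] by blast
    qed
  qed
  moreover have "conj_of_atoms \<phi>" "wf_fm A \<phi>"
    unfolding \<phi>_def conj_of_atoms_foldr_FConj wf_foldr_FConj \<phi>s using net l
    by (auto simp: atoms_def network_def)
  ultimately show ?thesis using pp_definable_conj_of_atoms[of \<phi> A n] by (simp add: n_def)
qed

lemma solutions_order_cong:
  assumes "\<forall>s\<in>symbols A. order_invariant (interp A s)" "network A C D"
    and "v \<in> solutions A C D" "\<And>i j. v i < v j \<longleftrightarrow> w i < w j"
  shows "w \<in> solutions A C D"
proof -
  have "map w xs \<in> interp A s" if "(s, xs) \<in> C" for s xs
  proof (rule order_invariant_map)
    show "order_invariant (interp A s)" using assms(1,2) that by (auto simp: network_def)
    show "map v xs \<in> interp A s" using assms(3) that by (auto simp: solutions_def)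
  qed (rule assms(4))
  moreover have "w i < w j" if "(i, j) \<in> D" for i j
    using that assms(3) assms(4)[of i j] by (auto simp: solutions_def)
  ultimately show ?thesis by (auto simp: solutions_def)
qed

lemma solutions_strict_mono:
  assumes "\<forall>s\<in>symbols A. order_invariant (interp A s)" "network A C D"
    and "v \<in> solutions A C D" "strict_mono h"
  shows "(\<lambda>i. h (v i)) \<in> solutions A C D"
  by (rule solutions_order_cong[OF assms(1-3)]) (simp_all add: strict_mono_less[OF assms(4)])

section \<open>Operations refining the minimum\<close>

text \<open>The common property of min, mi and mx that carries the proof. Ties between equal minima, which
  the three operations break differently, are left open.\<close>

definition refines_min :: "(rat \<Rightarrow> rat \<Rightarrow> rat) \<Rightarrow> bool" where
  "refines_min f \<longleftrightarrow> (\<forall>a b a' b'. min a b < min a' b' \<longrightarrow> f a b < f a' b')"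

lemma refines_minD: "refines_min f \<Longrightarrow> min a b < min a' b' \<Longrightarrow> f a b < f a' b'"
  by (auto simp: refines_min_def)

lemma refines_min_min: "refines_min min"
  by (simp add: refines_min_def)

lemma refines_min_mi:
  assumes "is_mi f" shows "refines_min f"
proof -
  obtain \<alpha> \<beta> \<gamma> :: "rat \<Rightarrow> rat" where
    m: "\<And>a e. e > 0 \<Longrightarrow> \<alpha> a < \<beta> a \<and> \<beta> a < \<gamma> a \<and> \<gamma> a < \<alpha> (a + e)"
    and f: "\<And>x y. f x y = (if x = y then \<alpha> x else if x > y then \<beta> y else \<gamma> x)"
    using assms unfolding is_mi_def by blast
  have "f a b \<le> \<gamma> (min a b)" "\<alpha> (min a b) \<le> f a b" for a b
    using m[of 1 a] m[of 1 b] by (auto simp: f min_def)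
  moreover have "\<gamma> x < \<alpha> y" if "x < y" for x y using m[of "y - x" x] that by simp
  ultimately show ?thesis unfolding refines_min_def by (meson le_less_trans less_le_trans)
qed

lemma refines_min_mx:
  assumes "is_mx f" shows "refines_min f"
proof -
  obtain \<alpha> \<beta> :: "rat \<Rightarrow> rat" where
    m: "\<And>a e. e > 0 \<Longrightarrow> \<alpha> a < \<beta> a \<and> \<beta> a < \<alpha> (a + e)"
    and f: "\<And>x y. f x y = (if x \<noteq> y then \<alpha> (min x y) else \<beta> x)"
    using assms unfolding is_mx_def by blast
  have "f a b \<le> \<beta> (min a b)" "\<alpha> (min a b) \<le> f a b" for a b
    using m[of 1 a] m[of 1 b] by (auto simp: f min_def)
  moreover have "\<beta> x < \<alpha> y" if "x < y" for x y using m[of "y - x" x] that by simp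
  ultimately show ?thesis unfolding refines_min_def by (meson le_less_trans less_le_trans)
qed

lemma inj_ll:
  assumes "is_ll f" shows "inj (\<lambda>(x, y). f x y)"
proof (rule injI, clarify)
  fix a b a' b' assume "f a b = f a' b'"
  then have "\<not> f a b < f a' b'" "\<not> f a' b' < f a b" by auto
  then show "a = a' \<and> b = b'" using assms unfolding is_ll_def by (smt (verit) linorder_less_linear not_less)
qed

lemma solutions_polymorphism:
  assumes "binary_polymorphism A f" "refines_min f" "network A C D"
    and "v \<in> solutions A C D" "w \<in> solutions A C D"
  shows "(\<lambda>i. f (v i) (w i)) \<in> solutions A C D"
proof -
  have "map (\<lambda>i. f (v i) (w i)) xs \<in> interp A s" if "(s, xs) \<in> C" for s xs
  proof -
    have "map v xs \<in> interp A s" "map w xs \<in> interp A s" "s \<in> symbols A"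
      using that assms(3-5) by (auto simp: solutions_def network_def)
    then have "map2 f (map v xs) (map w xs) \<in> interp A s"
      using assms(1) by (auto simp: binary_polymorphism_def preserves_def)
    moreover have "map2 f (map v xs) (map w xs) = map (\<lambda>i. f (v i) (w i)) xs"
      by (simp add: list_eq_iff_nth_eq)
    ultimately show ?thesis by simp
  qed
  moreover have "f (v i) (w i) < f (v j) (w j)" if "(i, j) \<in> D" for i j
    using that assms(4,5) by (intro refines_minD[OF assms(2)]) (auto simp: solutions_def min_def)
  ultimately show ?thesis by (auto simp: solutions_def)
qed

section \<open>Defining \<open>R_mix\<close> from an entailed equality\<close>

text \<open>Two chains, with points \<open>x\<close>, \<open>u\<close> in one and \<open>m\<close>, \<open>z\<close> in the other, can be merged with \<open>x\<close> below
  \<open>z\<close> and \<open>m\<close> below \<open>u\<close> unless this closes a cycle \<open>x < z \<le> m < u \<le> x\<close>. If \<open>m < z\<close> the second chain is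
  stretched over the first, otherwise it is squeezed between \<open>x\<close> and \<open>u\<close>.\<close>

lemma strict_mono_interleaving:
  fixes x u z m :: rat
  assumes "x < u \<or> m < z"
  shows "\<exists>h. strict_mono h \<and> x < h z \<and> h m < u"
proof (cases "m < z")
  case True
  define k where "k = (\<bar>x - u\<bar> + 2) / (z - m)"
  have "k > 0" "k * (z - m) = \<bar>x - u\<bar> + 2" using True by (auto simp: k_def)
  then show ?thesis
    by (intro exI[of _ "\<lambda>y. u - 1 + k * (y - m)"]) (auto simp: strict_mono_def abs_if split: if_splits)
next
  case False
  then have xu: "x < u" using assms by simp
  define M where "M = m - z + 1"
  define k where "k = (u - x) / (4 * M)"
  have pos: "M > 0" "m - z \<le> M" using False by (simp_all add: M_def)
  have k: "k > 0" using pos xu by (simp add: k_def)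
  have "k * (m - z) \<le> k * M" using k pos by simp
  also have "\<dots> = (u - x) / 4" using pos by (simp add: k_def)
  finally have "(x + u) / 2 + k * (m - z) < u" using xu by (simp add: field_simps)
  then show ?thesis using xu k
    by (intro exI[of _ "\<lambda>y. (x + u) / 2 + k * (y - z)"]) (auto simp: strict_mono_def)
qed

text \<open>If one of the bounds failed, \<open>t\<close> could be moved so that \<open>s i\<close> lies below \<open>t j\<close>, and the smaller of
  \<open>t p\<close>, \<open>t q\<close> below \<open>s p = s q\<close>. Then the pointwise minimum of \<open>s\<close> and \<open>t\<close> inherits \<open>i < j\<close> from \<open>s\<close>
  and \<open>p \<noteq> q\<close> from \<open>t\<close>, hence so does the pointwise application of \<open>f\<close>.\<close>

lemma entailed_equality_bounds:
  assumes inv: "\<forall>s\<in>symbols A. order_invariant (interp A s)"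
    and net: "network A C D" and f: "binary_polymorphism A f" "refines_min f"
    and ent: "\<forall>v\<in>solutions A C D. v i < v j \<longrightarrow> v p = v q"
    and s: "s \<in> solutions A C D" "s i < s j" and t: "t \<in> solutions A C D" "t p \<noteq> t q"
  shows "s p \<le> s i" and "t j \<le> t p" and "t j \<le> t q"
proof -
  have tij: "t j \<le> t i" using ent t by force
  have spq: "s p = s q" using ent s by blast
  have "\<not> (s i < s p \<or> min (t p) (t q) < t j)"
  proof
    assume "s i < s p \<or> min (t p) (t q) < t j"
    then obtain h where h: "strict_mono h" "s i < h (t j)" "h (min (t p) (t q)) < s p"
      using strict_mono_interleaving by blast
    define v where "v = (\<lambda>k. f (s k) (h (t k)))"
    have "v \<in> solutions A C D" unfolding v_def
      by (intro solutions_polymorphism[OF f net s(1)] solutions_strict_mono[OF inv net t(1) h(1)])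
    moreover have "v i < v j" unfolding v_def
    proof (rule refines_minD[OF f(2)])
      have "h (t j) \<le> h (t i)" using h(1) tij by (simp add: strict_mono_less_eq)
      then show "min (s i) (h (t i)) < min (s j) (h (t j))" using h(2) s(2) by auto
    qed
    moreover have "v p \<noteq> v q"
    proof (cases "t p < t q")
      case True
      then have "h (t p) < h (t q)" using h(1) by (simp add: strict_mono_less)
      then have "v p < v q" unfolding v_def
        using True h(3) spq by (intro refines_minD[OF f(2)]) (auto simp: min_def)
      then show ?thesis by simp
    next
      case False
      then have "t q < t p" using t(2) by simp
      then have "h (t q) < h (t p)" using h(1) by (simp add: strict_mono_less)
      then have "v q < v p" unfolding v_def
        using \<open>t q < t p\<close> h(3) spq by (intro refines_minD[OF f(2)]) (auto simp: min_def)
      then show ?thesis by simp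
    qed
    ultimately show False using ent by blast
  qed
  then show "s p \<le> s i" "t j \<le> t p" "t j \<le> t q" by auto
qed

lemma two_piece_strict_mono:
  fixes a b u w c x :: rat
  assumes "a < b" "u < w" "c < u" "x \<le> a"
  shows "\<exists>h. strict_mono h \<and> h a = u \<and> h b = w \<and> c < h x"
proof -
  define M where "M = a - x + 1"
  define k where "k = (u - c) / (2 * M)"
  define k' where "k' = (w - u) / (b - a)"
  have pos: "M > 0" "a - x \<le> M" using assms by (simp_all add: M_def)
  have k: "k > 0" "k' > 0" "k' * (b - a) = w - u" using assms pos by (auto simp: k_def k'_def)
  have "k * (a - x) \<le> k * M" using k pos by simp
  also have "\<dots> = (u - c) / 2" using pos by (simp add: k_def)
  also have "\<dots> < u - c" using assms by simp
  finally have kx: "k * (a - x) < u - c" .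
  define h where "h = (\<lambda>y. if y \<le> a then u - k * (a - y) else u + k' * (y - a))"
  have "h y < h z" if "y < z" for y z
  proof -
    consider "z \<le> a" | "y \<le> a" "a < z" | "a < y" by linarith
    then show ?thesis
    proof cases
      case 2
      then have "0 \<le> k * (a - y)" "0 < k' * (z - a)" using k by auto
      then show ?thesis using 2 by (simp add: h_def)
    qed (use that k in \<open>auto simp: h_def\<close>)
  qed
  then have "strict_mono h" by (simp add: strict_mono_def)
  moreover have "h a = u" "h b = w" "c < h x" using assms k kx by (auto simp: h_def)
  ultimately show ?thesis by blast
qed

lemma R_mix_Cons_iff: "[x, y, z] \<in> R_mix \<longleftrightarrow> x = y \<or> z < x \<and> z < y"
  by (auto simp: R_mix_def)

text \<open>Renaming of a variable \<open>k\<close> in copy \<open>b\<close> of a network, the two copies sharing \<open>p\<close>; the value \<open>None\<close> is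
  kept free for one further variable.\<close>

definition glue :: "'i \<Rightarrow> bool \<Rightarrow> 'i \<Rightarrow> (bool \<times> 'i) option" where
  "glue p b k = Some (b \<and> k \<noteq> p, k)"

text \<open>The network expresses \<open>\<exists>z. S (z, x, c) \<and> S (z, y, c)\<close>, where \<open>S (u, w, c)\<close> says that some
  solution has \<open>p = u\<close>, \<open>q = w\<close> and \<open>c < j\<close>. The existential \<open>z\<close> makes up for the fact that \<open>S\<close> may
  lack the triples with \<open>c < w < u\<close>.\<close>

lemma R_mix_network:
  fixes C :: "('s \<times> 'i list) set"
  assumes inv: "\<forall>s\<in>symbols A. order_invariant (interp A s)"
    and net: "network A C D" and f: "binary_polymorphism A f" "refines_min f"
    and ent: "\<forall>v\<in>solutions A C D. v i < v j \<longrightarrow> v p = v q"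
    and s: "s \<in> solutions A C D" "s i < s j" and t: "t \<in> solutions A C D" "t p < t q"
  shows "\<exists>C' D' js. network A C' D' \<and> length js = 3 \<and>
    {map v (js :: (bool \<times> 'i) option list) | v. v \<in> solutions A C' D'} = R_mix"
proof -
  let ?S = "solutions A C D"
  have tn: "t p \<noteq> t q" using t(2) by simp
  have pq: "p \<noteq> q" using t(2) by auto
  \<comment> \<open>with \<open>u\<close>, \<open>w\<close>, \<open>c\<close> as in \<open>S\<close>: \<open>upper\<close> bounds \<open>S\<close> from above, \<open>equal\<close> and \<open>less\<close> from below\<close>
  have upper: "v p = v q \<or> v j \<le> v p \<and> v j \<le> v q" if "v \<in> ?S" for v
    using entailed_equality_bounds(2,3)[OF inv net f ent s that] by blast
  have equal: "\<exists>v\<in>?S. v p = u \<and> v q = u \<and> c < v j" for u c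
  proof -
    have sp: "s p = s q" "s p \<le> s i"
      using ent s entailed_equality_bounds(1)[OF inv net f ent s t(1) tn] by auto
    define k where "k = (\<bar>c - u\<bar> + 1) / (s j - s p)"
    have k: "k > 0" "k * (s j - s p) = \<bar>c - u\<bar> + 1" using sp s(2) by (auto simp: k_def)
    have "(\<lambda>y. u + k * (s y - s p)) \<in> ?S"
      by (rule solutions_strict_mono[OF inv net s(1), of "\<lambda>y. u + k * (y - s p)"])
        (use k in \<open>auto simp: strict_mono_def\<close>)
    then show ?thesis using sp k by (intro bexI) (auto simp: abs_if)
  qed
  have less: "\<exists>v\<in>?S. v p = u \<and> v q = w \<and> c < v j" if cu: "c < u" and uw: "u < w" for u w c
  proof -
    have "t j \<le> t p" using entailed_equality_bounds(2)[OF inv net f ent s t(1) tn] .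
    then obtain h where h: "strict_mono h" "h (t p) = u" "h (t q) = w" "c < h (t j)"
      using two_piece_strict_mono[OF t(2) uw cu] by blast
    then show ?thesis using solutions_strict_mono[OF inv net t(1) h(1)] by (intro bexI) auto
  qed
  define C' where "C' = (\<lambda>(b, s, xs). (s, map (glue p b) xs)) ` (UNIV \<times> C)"
  define D' where "D' = (\<lambda>(b, k, l). (glue p b k, glue p b l)) ` (UNIV \<times> D)
    \<union> (\<lambda>b. (None, glue p b j)) ` UNIV"
  define js where "js = [glue p False q, glue p True q, None]"
  have net': "network A C' D'" using net by (auto simp: network_def C'_def D'_def)
  have sol: "v \<in> solutions A C' D' \<longleftrightarrow>
      (\<forall>b. v \<circ> glue p b \<in> ?S) \<and> (\<forall>b. v None < v (glue p b j))" for v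
    unfolding solutions_def C'_def D'_def by (fastforce simp: ball_Un split_beta comp_def)
  have "{map v js | v. v \<in> solutions A C' D'} = R_mix" (is "?L = _")
  proof
    show "?L \<subseteq> R_mix"
    proof
      fix r assume "r \<in> ?L"
      then obtain v where v: "r = map v js" "v \<in> solutions A C' D'" by blast
      have *: "v (glue p b p) = v (glue p b q)
          \<or> v None < v (glue p b p) \<and> v None < v (glue p b q)" for b
      proof -
        have "v \<circ> glue p b \<in> ?S" "v None < v (glue p b j)" using v(2) sol by blast+
        then show ?thesis using upper[of "v \<circ> glue p b"] by auto
      qed
      have "glue p True p = glue p False p" by (simp add: glue_def)
      then show "r \<in> R_mix"
        using *[of True] *[of False] by (auto simp: v(1) js_def R_mix_Cons_iff)
    qed
    show "R_mix \<subseteq> ?L"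
    proof
      fix r assume "r \<in> R_mix"
      then obtain x y c where r: "r = [x, y, c]" and xy: "x = y \<or> c < x \<and> c < y"
        by (auto simp: R_mix_def)
      have ex: "\<exists>v\<in>?S. v p = min x y \<and> v q = z \<and> c < v j" if "z = x \<or> z = y" for z
      proof (cases "z = min x y")
        case False
        then show ?thesis using that xy by (intro less) (auto simp: min_def split: if_splits)
      qed (use equal in auto)
      obtain v1 v2 where v1: "v1 \<in> ?S" "v1 p = min x y" "v1 q = x" "c < v1 j"
        and v2: "v2 \<in> ?S" "v2 p = min x y" "v2 q = y" "c < v2 j"
        using ex[of x] ex[of y] by blast
      define v where "v = (\<lambda>k. case k of None \<Rightarrow> c | Some (b, k) \<Rightarrow> if b then v2 k else v1 k)"
      have "v \<circ> glue p True = v2" "v \<circ> glue p False = v1"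
        using v1(2) v2(2) by (auto simp: v_def glue_def)
      then have g: "v \<circ> glue p b = (if b then v2 else v1)" for b by (cases b) auto
      then have g': "v (glue p b k) = (if b then v2 k else v1 k)" for b k
        by (metis comp_apply)
      have "v \<in> solutions A C' D'" unfolding sol
        using v1 v2 by (auto simp: g g' v_def[THEN fun_cong, of None])
      moreover have "r = map v js" using v1 v2 by (simp add: r js_def g' v_def[THEN fun_cong, of None])
      ultimately show "r \<in> ?L" by blast
    qed
  qed
  then show ?thesis using net' by (intro exI[of _ C'] exI[of _ D'] exI[of _ js]) (simp add: js_def)
qed

section \<open>Compactness\<close>

text \<open>Weighting the \<open>n\<close>-th element by \<open>1 / 2 ^ n\<close> and summing over all predecessors maps the order into the
  reals and leaves above the image of each \<open>x\<close> a gap as long as the weight of \<open>x\<close>; a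
  rational number chosen from the gap serves as the new image.\<close>

lemma strict_linear_order_embeds_rat:
  fixes R :: "'a::countable \<Rightarrow> 'a \<Rightarrow> bool"
  assumes irr: "\<And>x. \<not> R x x" and trans: "\<And>x y z. R x y \<Longrightarrow> R y z \<Longrightarrow> R x z"
    and total: "\<And>x y. x \<noteq> y \<Longrightarrow> R x y \<or> R y x"
  shows "\<exists>h :: 'a \<Rightarrow> rat. \<forall>x y. R x y \<longleftrightarrow> h x < h y"
proof -
  define c where "c = (\<lambda>x n. if \<exists>z. R z x \<and> to_nat z = n then (1/2::real) ^ n else 0)"
  have summ: "summable (c x)" for x
    by (rule summable_comparison_test'[where g = "\<lambda>n. (1/2) ^ n"]) (auto simp: c_def summable_geometric)
  define S where "S = (\<lambda>x. suminf (c x))"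
  have gap: "S x + (1/2) ^ to_nat x \<le> S y" if "R x y" for x y
  proof -
    define d where "d = (\<lambda>n. if n = to_nat x then (1/2::real) ^ n else 0)"
    have d: "d sums ((1/2) ^ to_nat x)" unfolding d_def by (rule sums_single)
    have le: "c x n + d n \<le> c y n" for n
    proof (cases "n = to_nat x")
      case True
      then show ?thesis using that irr by (auto simp: c_def d_def)
    next
      case False
      then show ?thesis using that trans by (auto simp: c_def d_def)
    qed
    have "S x + (1/2) ^ to_nat x = suminf (\<lambda>n. c x n + d n)"
      using suminf_add[OF summ sums_summable[OF d]] sums_unique[OF d] by (simp add: S_def)
    also have "\<dots> \<le> S y" unfolding S_def
      by (rule suminf_le[OF le summable_add[OF summ sums_summable[OF d]] summ])
    finally show ?thesis .
  qed
  have "\<forall>x. \<exists>r::rat. S x < of_rat r \<and> of_rat r < S x + (1/2) ^ to_nat x"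
    by (intro allI of_rat_dense) simp
  then obtain h :: "'a \<Rightarrow> rat" where
    h: "\<And>x. S x < of_rat (h x)" "\<And>x. of_rat (h x) < S x + (1/2) ^ to_nat x"
    by metis
  have "h x < h y" if "R x y" for x y
  proof -
    have "of_rat (h x) < (of_rat (h y) :: real)" using h(2)[of x] gap[OF that] h(1)[of y] by linarith
    then show ?thesis by (simp add: of_rat_less)
  qed
  then show ?thesis using irr total by (metis less_asym less_irrefl)
qed

lemma strict_mono_subsequence_constant:
  fixes B :: "nat \<Rightarrow> bool"
  shows "\<exists>r :: nat \<Rightarrow> nat. strict_mono r \<and> (\<forall>k l. B (r k) \<longleftrightarrow> B (r l))"
proof -
  have "infinite {n. B n} \<or> infinite {n. \<not> B n}"
    using infinite_UNIV_nat finite_Un[of "{n. B n}" "{n. \<not> B n}"]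
    by (metis Collect_neg_eq Compl_partition)
  then obtain b where inf: "infinite {n. B n = b}"
  proof
    assume "infinite {n. B n}"
    then show thesis using that[of True] by simp
  next
    assume "infinite {n. \<not> B n}"
    then show thesis using that[of False] by simp
  qed
  have "B (wellorder_class.enumerate {n. B n = b} k) = b" for k using enumerate_in_set[OF inf, of k] by simp
  then show ?thesis
    using strict_mono_enumerate[OF inf] by (intro exI[of _ "wellorder_class.enumerate {n. B n = b}"]) simp
qed

lemma pointwise_eventually_constant_subsequence:
  fixes B :: "nat \<Rightarrow> 'a::countable \<Rightarrow> bool"
  shows "\<exists>(r :: nat \<Rightarrow> nat) L. strict_mono r \<and> (\<forall>x. \<forall>\<^sub>F n in sequentially. B (r n) x \<longleftrightarrow> L x)"
proof -
  define P where "P = (\<lambda>m (r :: nat \<Rightarrow> nat). \<forall>k l. B (r k) (from_nat m) \<longleftrightarrow> B (r l) (from_nat m))"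
  interpret subseqs P
  proof
    fix n and s :: "nat \<Rightarrow> nat"
    show "\<exists>r'. strict_mono r' \<and> P n (s \<circ> r')"
      using strict_mono_subsequence_constant[of "\<lambda>k. B (s k) (from_nat n)"] by (simp add: P_def)
  qed
  have P: "P m (diagseq \<circ> ((+) (Suc m)))" for m
    by (rule diagseq_holds) (auto simp: P_def)
  have "\<exists>b. \<forall>\<^sub>F n in sequentially. B (diagseq n) x \<longleftrightarrow> b" for x
  proof -
    let ?N = "Suc (to_nat x)"
    have "B (diagseq n) x = B (diagseq ?N) x" if "n \<ge> ?N" for n
    proof -
      have "B ((diagseq \<circ> ((+) ?N)) (n - ?N)) (from_nat (to_nat x))
          = B ((diagseq \<circ> ((+) ?N)) 0) (from_nat (to_nat x))"
        using P[of "to_nat x"] unfolding P_def by blast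
      then show ?thesis using that by simp
    qed
    then show ?thesis by (auto simp: eventually_sequentially)
  qed
  then show ?thesis using subseq_diagseq by metis
qed

text \<open>The variable \<open>(a, b)\<close> stands for the value of an operation at \<open>a\<close> and \<open>b\<close>, so that the solutions
  are the operations that send any two tuples over \<open>F\<close> of a relation to a tuple of that relation;
  their values outside \<open>F \<times> F\<close> are arbitrary.\<close>

definition indicator_atoms ::
    "('s, rat) rel_struct \<Rightarrow> rat set \<Rightarrow> ('s \<times> (rat \<times> rat) list) set" where
  "indicator_atoms A F = {(s, zip t t') | s t t'. s \<in> symbols A \<and> t \<in> interp A s \<and>
     t' \<in> interp A s \<and> set t \<subseteq> F \<and> set t' \<subseteq> F}"

lemma network_indicator:
  assumes "finite (symbols A)" "finite F"
    and len: "\<forall>s\<in>symbols A. \<forall>t\<in>interp A s. length t = arity A s"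
  shows "network A (indicator_atoms A F) {}"
proof -
  let ?T = "\<lambda>s. {t. set t \<subseteq> F \<and> length t = arity A s}"
  have "indicator_atoms A F \<subseteq> (\<Union>s\<in>symbols A. (\<lambda>(t, t'). (s, zip t t')) ` (?T s \<times> ?T s))"
    using len by (fastforce simp: indicator_atoms_def)
  moreover have "finite \<dots>"
    using assms(1,2) by (intro finite_UN_I finite_imageI finite_cartesian_product finite_lists_length_eq)
  ultimately have "finite (indicator_atoms A F)" by (rule finite_subset)
  then show ?thesis using len by (auto simp: network_def indicator_atoms_def)
qed

lemma projections_solve_indicator:
  assumes len: "\<forall>s\<in>symbols A. \<forall>t\<in>interp A s. length t = arity A s"
  shows "fst \<in> solutions A (indicator_atoms A F) {}" "snd \<in> solutions A (indicator_atoms A F) {}"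
proof -
  have "map fst xs \<in> interp A s \<and> map snd xs \<in> interp A s"
    if mem: "(s, xs) \<in> indicator_atoms A F" for s xs
  proof -
    obtain t t' where t: "s \<in> symbols A" "t \<in> interp A s" "t' \<in> interp A s" "xs = zip t t'"
      using mem by (auto simp: indicator_atoms_def)
    then have "length t = length t'" using len by simp
    then show ?thesis using t by simp
  qed
  then show "fst \<in> solutions A (indicator_atoms A F) {}"
    "snd \<in> solutions A (indicator_atoms A F) {}"
    by (auto simp: solutions_def)
qed

text \<open>Solutions for larger and larger finite sets need not converge, but whether they map one pair below
  another is a yes-no question for each of countably many choices of two pairs, so along a subsequence all
  answers stabilise. The limiting answers order the pairs strictly and linearly, injectivity
  giving totality, and an embedding of this order into the rationals is the polymorphism:
  the relations depend only on the order type.\<close>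

lemma injective_polymorphism_compactness:
  assumes inv: "\<forall>s\<in>symbols A. order_invariant (interp A s)"
    and len: "\<forall>s\<in>symbols A. \<forall>t\<in>interp A s. length t = arity A s"
    and loc: "\<And>F. finite F \<Longrightarrow> \<exists>v\<in>solutions A (indicator_atoms A F) {}. inj_on v (F \<times> F)"
  shows "\<exists>g. binary_polymorphism A g \<and> inj (\<lambda>(x, y). g x y)"
proof -
  \<comment> \<open>an exhaustion of the rationals by finite sets\<close>
  define F where "F = (\<lambda>n. {q::rat. to_nat q < n})"
  have finF: "finite (F n)" for n
    using finite_vimageI[of "{..<n}" "to_nat :: rat \<Rightarrow> nat"] by (simp add: F_def vimage_def)
  have evF: "\<forall>\<^sub>F n in sequentially. q \<in> F n" for q
    using eventually_gt_at_top[of "to_nat q"] by (simp add: F_def)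
  obtain V where V: "\<And>n. V n \<in> solutions A (indicator_atoms A (F n)) {}"
    "\<And>n. inj_on (V n) (F n \<times> F n)"
    using loc[OF finF] by metis
  obtain r and L :: "(rat \<times> rat) \<times> (rat \<times> rat) \<Rightarrow> bool" where r: "strict_mono r"
    and L: "\<And>z. \<forall>\<^sub>F n in sequentially. V (r n) (fst z) < V (r n) (snd z) \<longleftrightarrow> L z"
    using pointwise_eventually_constant_subsequence[of "\<lambda>n z. V n (fst z) < V n (snd z)"] by blast
  have evr: "\<forall>\<^sub>F n in sequentially. q \<in> F (r n)" for q
    using evF filterlim_subseq[OF r] by (auto simp: filterlim_iff)
  define R where "R = (\<lambda>x y. L (x, y))"
  have R: "\<forall>\<^sub>F n in sequentially. V (r n) x < V (r n) y \<longleftrightarrow> R x y" for x y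
    using L[of "(x, y)"] by (simp add: R_def)
  have "\<not> R x x" for x
    using eventually_happens[OF R[of x x]] by simp
  moreover have "R x z" if "R x y" "R y z" for x y z
  proof -
    have "\<forall>\<^sub>F n in sequentially. R x z"
      using R[of x y] R[of y z] R[of x z] by eventually_elim (use that in auto)
    then show ?thesis by simp
  qed
  moreover have "R x y \<or> R y x" if "x \<noteq> y" for x y
  proof -
    have "\<forall>\<^sub>F n in sequentially. R x y \<or> R y x"
      using R[of x y] R[of y x] evr[of "fst x"] evr[of "snd x"] evr[of "fst y"] evr[of "snd y"]
    proof eventually_elim
      case (elim n)
      have "V (r n) x \<noteq> V (r n) y"
        using inj_onD[OF V(2)[of "r n"], of x y] elim that by (auto simp: mem_Times_iff)
      then show ?case using elim by auto
    qed
    then show ?thesis by simp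
  qed
  ultimately obtain h :: "rat \<times> rat \<Rightarrow> rat" where h: "\<And>x y. R x y \<longleftrightarrow> h x < h y"
    using strict_linear_order_embeds_rat[of R] by metis
  define g where "g = curry h"
  have "binary_polymorphism A g" unfolding binary_polymorphism_def preserves_def
  proof (intro ballI)
    fix s t t' assume s: "s \<in> symbols A" and t: "t \<in> interp A s" "t' \<in> interp A s"
    have ev: "\<forall>\<^sub>F n in sequentially. (\<forall>x\<in>set (zip t t'). \<forall>y\<in>set (zip t t'). V (r n) x < V (r n) y \<longleftrightarrow> R x y)
        \<and> (\<forall>q\<in>set t \<union> set t'. q \<in> F (r n))"
      by (intro eventually_conj eventually_ball_finite ballI R evr) auto
    obtain n where n:
      "\<forall>x\<in>set (zip t t'). \<forall>y\<in>set (zip t t'). V (r n) x < V (r n) y \<longleftrightarrow> R x y"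
      "set t \<union> set t' \<subseteq> F (r n)"
      using eventually_happens'[OF sequentially_bot ev] by blast
    have "(s, zip t t') \<in> indicator_atoms A (F (r n))"
      unfolding indicator_atoms_def using s t n(2) by blast
    then have "map (V (r n)) (zip t t') \<in> interp A s"
      using V(1)[of "r n"] by (auto simp: solutions_def)
    then have "map h (zip t t') \<in> interp A s"
      by (rule order_invariant_map[OF inv[rule_format, OF s]]) (use n(1) h in auto)
    then show "map2 g t t' \<in> interp A s" by (simp add: g_def curry_def case_prod_eta)
  qed
  moreover have "inj h"
    using h \<open>\<And>x y. x \<noteq> y \<Longrightarrow> R x y \<or> R y x\<close> by (metis injI less_irrefl)
  then have "inj (\<lambda>(x, y). g x y)" by (simp add: g_def)
  ultimately show ?thesis by blast
qed

section \<open>From the lack of injective polymorphisms to \<open>R_mix\<close>\<close>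

lemma finite_set_threshold:
  assumes "finite D" "Q D" "\<not> Q {}"
  shows "\<exists>D'\<subseteq>D. \<exists>e\<in>D. \<not> Q D' \<and> Q (insert e D')"
  using assms
proof (induction D rule: finite_induct)
  case (insert e D)
  then show ?case by (cases "Q D") blast+
qed simp

text \<open>Disequalities cannot be added to a network, whereas order constraints can. This is why \<open>s\<close> is chosen to
  maximise strict comparisons: a solution respecting all of them and separating one more pair would
  have more of them.\<close>

lemma entailed_equality_exists:
  assumes net: "network A C {}" and X: "finite X"
    and sep: "\<And>p q. p \<noteq> q \<Longrightarrow> \<exists>v\<in>solutions A C {}. v p \<noteq> v q"
    and noinj: "\<And>v. v \<in> solutions A C {} \<Longrightarrow> \<not> inj_on v X"
    and ne: "solutions A C {} \<noteq> {}"
  shows "\<exists>D i j p q s t. network A C D \<and>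
    (\<forall>v\<in>solutions A C D. v i < v j \<longrightarrow> v p = v q) \<and>
    s \<in> solutions A C D \<and> s i < s j \<and> t \<in> solutions A C D \<and> t p < t q"
proof -
  define S where "S = solutions A C {}"
  define P where "P = (\<lambda>v::'b \<Rightarrow> rat. {(i, j). i \<in> X \<and> j \<in> X \<and> v i < v j})"
  have P_sub: "P v \<subseteq> X \<times> X" for v by (auto simp: P_def)
  have finP: "finite (P v)" for v using X P_sub finite_subset by blast
  have "\<forall>v. v \<in> S \<longrightarrow> card (P v) < Suc (card (X \<times> X))"
    using X P_sub by (intro allI impI le_imp_less_Suc card_mono) simp_all
  then obtain s where s: "s \<in> S"
    "\<And>v. v \<in> S \<Longrightarrow> card (P v) \<le> card (P s)"
    using ne[folded S_def] ex_has_greatest_nat[of "\<lambda>v. v \<in> S" _ "\<lambda>v. card (P v)"] by blast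
  obtain p q where pq: "p \<in> X" "q \<in> X" "p \<noteq> q" "s p = s q"
    using noinj[of s] s(1) by (auto simp: inj_on_def S_def)
  define Q where "Q = (\<lambda>D. \<forall>v\<in>solutions A C D. v p = v q)"
  have mem: "v \<in> solutions A C D \<longleftrightarrow> v \<in> S \<and> (\<forall>(i, j)\<in>D. v i < v j)" for v D
    by (auto simp: solutions_def S_def)
  have "Q (P s)" unfolding Q_def
  proof (intro ballI, rule ccontr)
    fix v assume v: "v \<in> solutions A C (P s)" "v p \<noteq> v q"
    have "P s \<subset> P v"
    proof
      show "P s \<subseteq> P v" using v(1) by (auto simp: mem P_def)
      have "(p, q) \<in> P v \<or> (q, p) \<in> P v" using v(2) pq by (auto simp: P_def)
      moreover have "(p, q) \<notin> P s" "(q, p) \<notin> P s" using pq(4) by (auto simp: P_def)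
      ultimately show "P s \<noteq> P v" by auto
    qed
    then have "card (P s) < card (P v)" using finP psubset_card_mono by blast
    then show False using s(2)[of v] v(1) by (simp add: mem)
  qed
  moreover have "\<not> Q {}" using sep[OF pq(3)] by (auto simp: Q_def)
  ultimately obtain D e where D: "D \<subseteq> P s" "e \<in> P s" "\<not> Q D" "Q (insert e D)"
    using finite_set_threshold[of "P s" Q] finP by blast
  obtain i j where e: "e = (i, j)" by (cases e)
  obtain t where t: "t \<in> solutions A C D" "t p \<noteq> t q" using D(3) by (auto simp: Q_def)
  have ent: "\<forall>v\<in>solutions A C D. v i < v j \<longrightarrow> v p = v q"
    using D(4) by (auto simp: Q_def e mem)
  have sD: "s \<in> solutions A C D" "s i < s j" using s(1) D(1,2) by (auto simp: mem P_def e)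
  have net': "network A C D" using net finite_subset[OF D(1) finP] by (simp add: network_def)
  show ?thesis
  proof (cases "t p < t q")
    case True
    show ?thesis
      by (intro exI[of _ D] exI[of _ i] exI[of _ j] exI[of _ p] exI[of _ q] exI[of _ s] exI[of _ t])
        (use ent sD net' t(1) True in simp)
  next
    case False
    then have "t q < t p" using t(2) by simp
    moreover have "\<forall>v\<in>solutions A C D. v i < v j \<longrightarrow> v q = v p" using ent by auto
    ultimately show ?thesis
      by (intro exI[of _ D] exI[of _ i] exI[of _ j] exI[of _ q] exI[of _ p] exI[of _ s] exI[of _ t])
        (use sD net' t(1) in simp)
  qed
qed

lemma no_injective_polymorphism_R_mix_network:
  assumes inv: "\<forall>s\<in>symbols A. order_invariant (interp A s)"
    and len: "\<forall>s\<in>symbols A. \<forall>t\<in>interp A s. length t = arity A s"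
    and fin: "finite (symbols A)" and f: "binary_polymorphism A f" "refines_min f"
    and noinj: "\<not> (\<exists>g. binary_polymorphism A g \<and> inj (\<lambda>(x, y). g x y))"
  shows "\<exists>C D js. network A C D \<and> length js = 3 \<and>
    {map v (js :: (bool \<times> rat \<times> rat) option list) | v. v \<in> solutions A C D} = R_mix"
proof -
  obtain F where F: "finite F"
    "\<And>v. v \<in> solutions A (indicator_atoms A F) {} \<Longrightarrow> \<not> inj_on v (F \<times> F)"
    using injective_polymorphism_compactness[OF inv len] noinj by blast
  let ?C = "indicator_atoms A F"
  have proj: "fst \<in> solutions A ?C {}" "snd \<in> solutions A ?C {}"
    using projections_solve_indicator[OF len] by auto
  have "\<exists>v\<in>solutions A ?C {}. v x \<noteq> v y" if "x \<noteq> y" for x y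
    using proj that by (metis prod_eqI)
  then have "\<exists>D i j p q s t. network A ?C D \<and>
      (\<forall>v\<in>solutions A ?C D. v i < v j \<longrightarrow> v p = v q) \<and>
      s \<in> solutions A ?C D \<and> s i < s j \<and> t \<in> solutions A ?C D \<and> t p < t q"
    using F proj(1)
    by (intro entailed_equality_exists[where X = "F \<times> F"] network_indicator[OF fin _ len]) auto
  then obtain D i j p q s t where *: "network A ?C D"
    "\<forall>v\<in>solutions A ?C D. v i < v j \<longrightarrow> v p = v q"
    "s \<in> solutions A ?C D" "s i < s j" "t \<in> solutions A ?C D" "t p < t q"
    by blast
  show ?thesis by (rule R_mix_network[OF inv *(1) f *(2-6)])
qed

section \<open>Duality\<close>

definition dual_struct :: "('s, rat) rel_struct \<Rightarrow> ('s, rat) rel_struct" where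
  "dual_struct A = A\<lparr>interp := \<lambda>s. dual_rel (interp A s)\<rparr>"

lemma dual_struct_simps [simp]:
  "symbols (dual_struct A) = symbols A" "arity (dual_struct A) = arity A"
  "interp (dual_struct A) s = dual_rel (interp A s)"
  by (auto simp: dual_struct_def)

lemma map2_dual_op:
  "map uminus (map2 (dual_op f) s t) = map2 f (map uminus s) (map uminus t)"
  by (induction s t rule: list_induct2') (auto simp: dual_op_def)

lemma preserves_dual_rel:
  assumes "preserves f R" shows "preserves (dual_op f) (dual_rel R)"
  using assms unfolding preserves_def dual_rel_def mem_Collect_eq map2_dual_op by blast

lemma dual_rel_dual_rel [simp]: "dual_rel (dual_rel R) = R"
  by (simp add: dual_rel_def comp_def)

lemma dual_op_dual_op [simp]: "dual_op (dual_op f) = f"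
  by (simp add: dual_op_def)

lemma polymorphism_dual_struct:
  "binary_polymorphism (dual_struct A) f \<longleftrightarrow> binary_polymorphism A (dual_op f)"
  using preserves_dual_rel unfolding binary_polymorphism_def dual_struct_simps
  by (metis dual_rel_dual_rel dual_op_dual_op)

lemma inj_dual_op:
  assumes "inj (\<lambda>(x, y). g x y)" shows "inj (\<lambda>(x, y). dual_op g x y)"
proof (rule injI, clarify)
  fix a b c d assume "dual_op g a b = dual_op g c d"
  then have "g (- a) (- b) = g (- c) (- d)" by (simp add: dual_op_def)
  then show "a = c \<and> b = d" using injD[OF assms, of "(- a, - b)" "(- c, - d)"] by simp
qed

lemma order_invariant_dual_rel:
  assumes "order_invariant R" shows "order_invariant (dual_rel R)"
  unfolding order_invariant_def
proof (intro ballI allI impI)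
  fix xs ys :: "rat list" assume xs: "xs \<in> dual_rel R" and len: "length ys = length xs"
    and o: "\<forall>i<length xs. \<forall>j<length xs. xs ! i < xs ! j \<longleftrightarrow> ys ! i < ys ! j"
  have "map uminus xs \<in> R" using xs by (simp add: dual_rel_def)
  then have "map uminus ys \<in> R" using assms len o unfolding order_invariant_def by auto
  then show "ys \<in> dual_rel R" by (simp add: dual_rel_def)
qed

text \<open>The converse appears because negation reverses the order constraints of a network.\<close>

lemma solutions_dual_struct:
  "v \<in> solutions (dual_struct A) C D \<longleftrightarrow> (\<lambda>i. - v i) \<in> solutions A C (D\<inverse>)"
  by (auto simp: solutions_def dual_rel_def comp_def)

section \<open>Injective polymorphisms and definability of \<open>R_mix\<close>\<close>

lemma sat_polymorphism:
  assumes "binary_polymorphism A g" "primitive_positive \<phi>" "wf_fm A \<phi>" "sat A v \<phi>" "sat A w \<phi>"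
  shows "sat A (\<lambda>x. g (v x) (w x)) \<phi>"
  using assms(2-5)
proof (induction \<phi> arbitrary: v w)
  case (FRel s xs)
  then have "map2 g (map v xs) (map w xs) \<in> interp A s"
    using assms(1) by (simp add: binary_polymorphism_def preserves_def)
  moreover have "map2 g (map v xs) (map w xs) = map (\<lambda>x. g (v x) (w x)) xs"
    by (simp add: list_eq_iff_nth_eq)
  ultimately show ?case by simp
next
  case (FConj \<phi> \<psi>)
  have "primitive_positive \<phi>" "primitive_positive \<psi>"
    using FConj.prems(1) primitive_positive_foldr_FEx[of _ "[]"] by auto
  then show ?case using FConj by auto
next
  case (FEx x \<phi>)
  then obtain a b where "sat A (v(x := a)) \<phi>" "sat A (w(x := b)) \<phi>" by auto
  then have "sat A (\<lambda>y. g ((v(x := a)) y) ((w(x := b)) y)) \<phi>"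
    using FEx.IH[of "v(x := a)" "w(x := b)"] FEx.prems(1,2) by (simp del: fun_upd_apply)
  moreover have "(\<lambda>y. g ((v(x := a)) y) ((w(x := b)) y)) = (\<lambda>y. g (v y) (w y))(x := g a b)" by auto
  ultimately show ?case by auto
qed auto

lemma pp_definable_preserved:
  assumes "binary_polymorphism A g" "pp_definable A n R"
  shows "preserves g R"
proof -
  obtain \<phi> where \<phi>: "primitive_positive \<phi>" "wf_fm A \<phi>" "R = {map v [0..<n] | v. sat A v \<phi>}"
    using assms(2) by (auto simp: pp_definable_def defines_rel_def)
  show ?thesis unfolding preserves_def
  proof (intro ballI)
    fix s t assume "s \<in> R" "t \<in> R"
    then obtain v w where vw: "s = map v [0..<n]" "sat A v \<phi>" "t = map w [0..<n]" "sat A w \<phi>"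
      using \<phi>(3) by auto
    have "map2 g s t = map (\<lambda>x. g (v x) (w x)) [0..<n]" using vw by (simp add: list_eq_iff_nth_eq)
    then show "map2 g s t \<in> R" using sat_polymorphism[OF assms(1) \<phi>(1,2) vw(2,4)] \<phi>(3) by blast
  qed
qed

text \<open>In each of the two triples exactly one of the disjuncts defining \<open>R_mix\<close> holds. An injective operation
  destroys the equality of the first triple whichever argument that triple is in, so the result must
  satisfy the second disjunct, and the two orders of the arguments contradict each other.\<close>

lemma injective_not_preserves_R_mix:
  assumes "inj (\<lambda>(x, y). g x y)"
  shows "\<not> preserves g R_mix"
proof
  assume p: "preserves g R_mix"
  have "map2 g [0, 0, 1] [1, 2, 0] \<in> R_mix" "map2 g [1, 2, 0] [0, 0, 1] \<in> R_mix"
    using p unfolding preserves_def by (auto simp: R_mix_Cons_iff simp del: list.map zip_Cons_Cons)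
  moreover have "g 0 1 \<noteq> g 0 2" "g 1 0 \<noteq> g 2 0"
    using injD[OF assms, of "(0, 1)" "(0, 2)"] injD[OF assms, of "(1, 0)" "(2, 0)"] by auto
  ultimately have "g 1 0 < g 0 1" "g 0 1 < g 1 0" by (simp_all add: R_mix_Cons_iff)
  then show False by simp
qed

theorem theorem4:
  fixes A :: "('s, rat) rel_struct" and f :: "rat \<Rightarrow> rat \<Rightarrow> rat"
  assumes "fo_expansion A" and "finite (symbols A)"
    and "f = min \<or> is_mi f \<or> is_mx f \<or> is_ll f"
    and "binary_polymorphism A f \<or> binary_polymorphism A (dual_op f)"
  shows "\<not> (\<exists>g. binary_polymorphism A g \<and> inj (\<lambda>(x, y). g x y)) \<longleftrightarrow>
         pp_definable A 3 R_mix \<or> pp_definable A 3 (dual_rel R_mix)"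
proof
  assume pp: "pp_definable A 3 R_mix \<or> pp_definable A 3 (dual_rel R_mix)"
  show "\<not> (\<exists>g. binary_polymorphism A g \<and> inj (\<lambda>(x, y). g x y))"
  proof clarify
    fix g assume g: "binary_polymorphism A g" and inj: "inj (\<lambda>(x, y). g x y)"
    have "preserves g R_mix \<or> preserves g (dual_rel R_mix)"
      using pp pp_definable_preserved[OF g] by blast
    then have "preserves g R_mix \<or> preserves (dual_op g) R_mix"
      using preserves_dual_rel[of g "dual_rel R_mix"] by auto
    then show False
      using injective_not_preserves_R_mix[OF inj] injective_not_preserves_R_mix[OF inj_dual_op[OF inj]]
      by blast
  qed
next
  assume noinj: "\<not> (\<exists>g. binary_polymorphism A g \<and> inj (\<lambda>(x, y). g x y))"
  have "\<not> is_ll f" using noinj assms(4) inj_ll[of f] inj_dual_op[of f] by blast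
  then have min: "refines_min f"
    using assms(3) refines_min_min refines_min_mi[of f] refines_min_mx[of f] by auto
  obtain l where l: "l \<in> symbols A" "arity A l = 2" "interp A l = less_rel"
    using assms(1) by (auto simp: fo_expansion_def)
  have fo: "fo_definable rat_order (arity A s) (interp A s)" if "s \<in> symbols A" for s
    using assms(1) that by (auto simp: fo_expansion_def)
  have inv: "\<forall>s\<in>symbols A. order_invariant (interp A s)"
    using fo_definable_order_invariant[OF fo] by blast
  have len: "\<forall>s\<in>symbols A. \<forall>t\<in>interp A s. length t = arity A s"
  proof (intro ballI)
    fix s t assume "s \<in> symbols A" and t: "t \<in> interp A s"
    then obtain \<phi> where "interp A s = {map v [0..<arity A s] | v. sat rat_order v \<phi>}"
      using fo unfolding fo_definable_def defines_rel_def by blast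
    then show "length t = arity A s" using t by auto
  qed
  show "pp_definable A 3 R_mix \<or> pp_definable A 3 (dual_rel R_mix)"
    using assms(4)
  proof
    assume f: "binary_polymorphism A f"
    obtain C D and js :: "(bool \<times> rat \<times> rat) option list" where
      net: "network A C D" "length js = 3" "{map v js | v. v \<in> solutions A C D} = R_mix"
      using no_injective_polymorphism_R_mix_network[OF inv len assms(2) f min noinj] by blast
    then show ?thesis using network_pp_definable[OF net(1) l, of js] by simp
  next
    assume "binary_polymorphism A (dual_op f)"
    then have f: "binary_polymorphism (dual_struct A) f" by (simp add: polymorphism_dual_struct)
    have noinj': "\<not> (\<exists>g. binary_polymorphism (dual_struct A) g \<and> inj (\<lambda>(x, y). g x y))"
      using noinj inj_dual_op unfolding polymorphism_dual_struct by blast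
    have len': "\<forall>s\<in>symbols (dual_struct A). \<forall>t\<in>interp (dual_struct A) s.
        length t = arity (dual_struct A) s"
    proof (intro ballI)
      fix s t assume "s \<in> symbols (dual_struct A)" "t \<in> interp (dual_struct A) s"
      then have "s \<in> symbols A" "map uminus t \<in> interp A s" by (simp_all add: dual_rel_def)
      then have "length (map uminus t) = arity A s" using len by blast
      then show "length t = arity (dual_struct A) s" by simp
    qed
    have inv': "\<forall>s\<in>symbols (dual_struct A). order_invariant (interp (dual_struct A) s)"
      using inv by (simp add: order_invariant_dual_rel)
    have fin': "finite (symbols (dual_struct A))" using assms(2) by simp
    obtain C D and js :: "(bool \<times> rat \<times> rat) option list" where
      net: "network (dual_struct A) C D" "length js = 3"
        "{map v js | v. v \<in> solutions (dual_struct A) C D} = R_mix"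
      using no_injective_polymorphism_R_mix_network[OF inv' len' fin' f min noinj'] by blast
    have "dual_rel R_mix = {map v js | v. v \<in> solutions A C (D\<inverse>)}"
    proof (intro set_eqI iffI)
      fix t assume "t \<in> dual_rel R_mix"
      then have "map uminus t \<in> R_mix" by (simp add: dual_rel_def)
      then obtain v where v: "map uminus t = map v js" "v \<in> solutions (dual_struct A) C D"
        using net(3) by blast
      have "t = map (\<lambda>i. - v i) js"
        using arg_cong[OF v(1), of "map uminus"] by (simp add: comp_def)
      then show "t \<in> {map v js | v. v \<in> solutions A C (D\<inverse>)}"
        using v(2) by (auto simp: solutions_dual_struct)
    next
      fix t assume "t \<in> {map v js | v. v \<in> solutions A C (D\<inverse>)}"
      then obtain v where v: "t = map v js" "v \<in> solutions A C (D\<inverse>)" by blast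
      then have "(\<lambda>i. - v i) \<in> solutions (dual_struct A) C D" by (simp add: solutions_dual_struct)
      then have "map (\<lambda>i. - v i) js \<in> R_mix" using net(3) by blast
      then show "t \<in> dual_rel R_mix" by (simp add: dual_rel_def v(1) comp_def)
    qed
    moreover have "network A C (D\<inverse>)" using net(1) by (simp add: network_def)
    ultimately show ?thesis using network_pp_definable[OF _ l, of C "D\<inverse>" js] net(2) by simp
  qed
qed

end
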